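(* Let $L$ be a countable relational language and let $T$ be a countable pithy $\Pi_2$ theory of $\mathcal{L}_{\omega_1,\omega}(L)$ that has duplication of quantifier-free types. Then there exists a Borel $L$-structure that strongly witnesses $T$.
   Context: $\mathcal{L}_{\omega_1,\omega}(L)$ is the infinitary logic with countable conjunctions/disjunctions and finitely many free variables per formula. A pithy $\Pi_2$ sentence has the form $(\forall\mathbf{x})(\exists y)\psi(\mathbf{x},y)$ with $\mathbf{x}y$ distinct variables ($\mathbf{x}$ possibly empty), $y$ a single variable, $\psi$ quantifier-free; a pithy $\Pi_2$ theory is a set of such sentences. A (complete) quantifier-free type $p(\mathbf{x})$ is a quantifier-free formula of $\mathcal{L}_{\omega_1,\omega}(L)$ whose free variables are exactly $\mathbf{x}$, such that $(\exists\mathbf{x})p(\mathbf{x})$ has a model and for every quantifier-free $\varphi(\mathbf{x})$ either $\models p\to\varphi$ or $\models p\to\neg\varphi$. It is consistent with $T$ if $T\cup\{(\exists\mathbf{x})p(\mathbf{x})\}$ has a model, and non-redundant if $p(x_1,\dots,x_n)$ implies $\bigwedge_{i<j}x_i\neq x_j$. $T$ has duplication of quantifier-free types if for every non-redundant quantifier-free type $p(x,\mathbf{z})$ consistent with $T$ there is a non-redundant quantifier-free type $q(x,y,\mathbf{z})$ consistent with $T$ with $\models q(x,y,\mathbf{z})\to(p(x,\mathbf{z})\wedge p(y,\mathbf{z}))$. A Borel $L$-structure is an $L$-structure with underlying set $\mathbb{R}$ each of whose relations is a Borel subset of the appropriate $\mathbb{R}^j$. For a probability measure $m$ on $\mathbb{R}$,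 $(\mathcal{P},m)$ witnesses $T$ if for every $(\forall\mathbf{x})(\exists y)\psi(\mathbf{x},y)\in T$ and every tuple of reals $\mathbf{a}$ with $|\mathbf{a}|=|\mathbf{x}|$, either $\mathcal{P}\models\psi(\mathbf{a},b)$ for some entry $b$ of $\mathbf{a}$ or $m(\{b:\mathcal{P}\models\psi(\mathbf{a},b)\})>0$. $\mathcal{P}$ strongly witnesses $T$ if $(\mathcal{P},m)$ witnesses $T$ for every nondegenerate probability measure $m$ on $\mathbb{R}$ (nondegenerate: every nonempty open set has positive measure).
   Formalization: The theory T is additionally assumed to have a model; without this the claim fails, e.g. for T = {(∃y) y≠y}, where duplication of quantifier-free types holds vacuously but no Borel structure can witness T. *)

theory Defs
  imports "HOL-Probability.Probability"
begin

text \<open>A relational language is the partial map sending each of its symbols to its arity.\<close>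

type_synonym 'r language = "'r \<rightharpoonup> nat"

text \<open>A nonempty countable family of formulas is the range of a sequence; the empty
  disjunction is \<open>Fls\<close> and the empty conjunction is \<open>Neg Fls\<close>.\<close>

datatype ('r, 'v) fm =
    Fls
  | Rel 'r "'v list"
  | Eq 'v 'v
  | Neg "('r, 'v) fm"
  | Conj "nat \<Rightarrow> ('r, 'v) fm"
  | Disj "nat \<Rightarrow> ('r, 'v) fm"
  | Forall 'v "('r, 'v) fm"
  | Exists 'v "('r, 'v) fm"

type_synonym 'r formula = "('r, nat) fm"

primrec fv :: "('r, 'v) fm \<Rightarrow> 'v set" where
  "fv Fls = {}"
| "fv (Rel r xs) = set xs"
| "fv (Eq x y) = {x, y}"
| "fv (Neg \<phi>) = fv \<phi>"
| "fv (Conj F) = (\<Union>i. fv (F i))"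
| "fv (Disj F) = (\<Union>i. fv (F i))"
| "fv (Forall x \<phi>) = fv \<phi> - {x}"
| "fv (Exists x \<phi>) = fv \<phi> - {x}"

primrec qf :: "('r, 'v) fm \<Rightarrow> bool" where
  "qf Fls = True"
| "qf (Rel r xs) = True"
| "qf (Eq x y) = True"
| "qf (Neg \<phi>) = qf \<phi>"
| "qf (Conj F) = (\<forall>i. qf (F i))"
| "qf (Disj F) = (\<forall>i. qf (F i))"
| "qf (Forall x \<phi>) = False"
| "qf (Exists x \<phi>) = False"

primrec well_formed :: "'r language \<Rightarrow> ('r, 'v) fm \<Rightarrow> bool" where
  "well_formed L Fls = True"
| "well_formed L (Rel r xs) = (L r = Some (length xs))"
| "well_formed L (Eq x y) = True"
| "well_formed L (Neg \<phi>) = well_formed L \<phi>"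
| "well_formed L (Conj F) = (\<forall>i. well_formed L (F i))"
| "well_formed L (Disj F) = (\<forall>i. well_formed L (F i))"
| "well_formed L (Forall x \<phi>) = well_formed L \<phi>"
| "well_formed L (Exists x \<phi>) = well_formed L \<phi>"

text \<open>Any subformula lies in the scope of finitely many quantifiers, so if the whole formula has
  finitely many free variables, then so has each of its subformulas.\<close>

definition is_formula :: "'r language \<Rightarrow> 'r formula \<Rightarrow> bool" where
  "is_formula L \<phi> \<longleftrightarrow> well_formed L \<phi> \<and> finite (fv \<phi>)"

definition Alls :: "'v list \<Rightarrow> ('r, 'v) fm \<Rightarrow> ('r, 'v) fm" where
  "Alls xs \<phi> = foldr Forall xs \<phi>"

definition Exs :: "'v list \<Rightarrow> ('r, 'v) fm \<Rightarrow> ('r, 'v) fm" where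
  "Exs xs \<phi> = foldr Exists xs \<phi>"

text \<open>Substitution of \<open>y\<close> for \<open>x\<close>. It also renames bound variables, and is only
  used for quantifier-free formulas.\<close>

definition subst :: "'v \<Rightarrow> 'v \<Rightarrow> ('r, 'v) fm \<Rightarrow> ('r, 'v) fm" where
  "subst x y p = map_fm id (id(x := y)) p"

record ('r, 'u) struct =
  univ :: "'u set"
  interp :: "'r \<Rightarrow> 'u list set"

definition is_structure :: "'r language \<Rightarrow> ('r, 'u) struct \<Rightarrow> bool" where
  "is_structure L M \<longleftrightarrow> univ M \<noteq> {} \<and>
     (\<forall>r j. L r = Some j \<longrightarrow> interp M r \<subseteq> {as. length as = j \<and> set as \<subseteq> univ M})"

primrec sat :: "('r, 'u) struct \<Rightarrow> ('v \<Rightarrow> 'u) \<Rightarrow> ('r, 'v) fm \<Rightarrow> bool" where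
  "sat M v Fls = False"
| "sat M v (Rel r xs) = (map v xs \<in> interp M r)"
| "sat M v (Eq x y) = (v x = v y)"
| "sat M v (Neg \<phi>) = (\<not> sat M v \<phi>)"
| "sat M v (Conj F) = (\<forall>i. sat M v (F i))"
| "sat M v (Disj F) = (\<exists>i. sat M v (F i))"
| "sat M v (Forall x \<phi>) = (\<forall>a\<in>univ M. sat M (v(x := a)) \<phi>)"
| "sat M v (Exists x \<phi>) = (\<exists>a\<in>univ M. sat M (v(x := a)) \<phi>)"

text \<open>\<open>holds_at M \<phi> xs as\<close> is satisfaction of \<open>\<phi>\<close> in \<open>M\<close> with the
  distinct variables \<open>xs\<close>, which are to include all free ones, interpreted by the tuple
  \<open>as\<close> of the same length.\<close>

definition holds_at :: "('r, 'u) struct \<Rightarrow> ('r, 'v) fm \<Rightarrow> 'v list \<Rightarrow> 'u list \<Rightarrow> bool" where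
  "holds_at M \<phi> xs as \<longleftrightarrow> sat M (the \<circ> map_of (zip xs as)) \<phi>"

text \<open>
  HOL cannot quantify over all structures irrespective of the type of their elements. Hence
  the semantic notions below take a type \<open>'u\<close> and range over all structures, finite and
  infinite, whose universe is a nonempty subset of \<open>'u\<close>. For infinite \<open>'u\<close>, countable
  languages and countable theories this is the usual notion, by the downward
  Loewenheim-Skolem theorem: whatever has a model has a countable one, and this can be copied
  into \<open>'u\<close>.
\<close>

definition has_model :: "'u itself \<Rightarrow> 'r language \<Rightarrow> 'r formula set \<Rightarrow> bool" where
  "has_model U L T \<longleftrightarrow>
     (\<exists>M :: ('r, 'u) struct. is_structure L M \<and>
        (\<forall>\<phi>\<in>T. \<forall>v. range v \<subseteq> univ M \<longrightarrow> sat M v \<phi>))"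

text \<open>\<open>entails U L \<phi> \<psi>\<close> says that the implication from \<open>\<phi>\<close> to \<open>\<psi>\<close> is valid.\<close>

definition entails :: "'u itself \<Rightarrow> 'r language \<Rightarrow> 'r formula \<Rightarrow> 'r formula \<Rightarrow> bool" where
  "entails U L \<phi> \<psi> \<longleftrightarrow>
     (\<forall>M :: ('r, 'u) struct. \<forall>v. is_structure L M \<and> range v \<subseteq> univ M \<longrightarrow>
        sat M v \<phi> \<longrightarrow> sat M v \<psi>)"

definition qf_type :: "'u itself \<Rightarrow> 'r language \<Rightarrow> nat list \<Rightarrow> 'r formula \<Rightarrow> bool" where
  "qf_type U L xs p \<longleftrightarrow>
     distinct xs \<and> is_formula L p \<and> qf p \<and> fv p = set xs \<and>
     has_model U L {Exs xs p} \<and>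
     (\<forall>\<phi>. is_formula L \<phi> \<and> qf \<phi> \<and> fv \<phi> \<subseteq> set xs \<longrightarrow>
        entails U L p \<phi> \<or> entails U L p (Neg \<phi>))"

definition consistent_with ::
    "'u itself \<Rightarrow> 'r language \<Rightarrow> 'r formula set \<Rightarrow> nat list \<Rightarrow> 'r formula \<Rightarrow> bool" where
  "consistent_with U L T xs p \<longleftrightarrow> has_model U L (T \<union> {Exs xs p})"

definition non_redundant ::
    "'u itself \<Rightarrow> 'r language \<Rightarrow> nat list \<Rightarrow> 'r formula \<Rightarrow> bool" where
  "non_redundant U L xs p \<longleftrightarrow>
     (\<forall>i j. i < j \<and> j < length xs \<longrightarrow> entails U L p (Neg (Eq (xs ! i) (xs ! j))))"

definition has_duplication :: "'u itself \<Rightarrow> 'r language \<Rightarrow> 'r formula set \<Rightarrow> bool" where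
  "has_duplication U L T \<longleftrightarrow>
     (\<forall>x zs p. qf_type U L (x # zs) p \<and> non_redundant U L (x # zs) p \<and>
        consistent_with U L T (x # zs) p \<longrightarrow>
        (\<exists>y q. qf_type U L (x # y # zs) q \<and> non_redundant U L (x # y # zs) q \<and>
           consistent_with U L T (x # y # zs) q \<and>
           entails U L q p \<and> entails U L q (subst x y p)))"

definition pithy_parts :: "'r language \<Rightarrow> nat list \<Rightarrow> nat \<Rightarrow> 'r formula \<Rightarrow> bool" where
  "pithy_parts L xs y \<psi> \<longleftrightarrow>
     distinct (xs @ [y]) \<and> is_formula L \<psi> \<and> qf \<psi> \<and> fv \<psi> \<subseteq> set (xs @ [y])"

definition pithy_theory :: "'r language \<Rightarrow> 'r formula set \<Rightarrow> bool" where
  "pithy_theory L T \<longleftrightarrow>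
     (\<forall>\<phi>\<in>T. \<exists>xs y \<psi>. pithy_parts L xs y \<psi> \<and> \<phi> = Alls xs (Exists y \<psi>))"

text \<open>\<open>\<real>\<^sup>j\<close> is represented by lists of length \<open>j\<close> in structures, and by
  functions on \<open>{..<j}\<close> in the measurability condition. As \<open>\<real>\<close> is second countable, the
  product sigma-algebra on \<open>\<real>\<^sup>j\<close> consists of the Borel sets.\<close>

definition borel_structure :: "'r language \<Rightarrow> ('r, real) struct \<Rightarrow> bool" where
  "borel_structure L P \<longleftrightarrow> is_structure L P \<and> univ P = UNIV \<and>
     (\<forall>r j. L r = Some j \<longrightarrow>
        {f \<in> space (PiM {..<j} (\<lambda>_. borel :: real measure)). map f [0..<j] \<in> interp P r}
          \<in> sets (PiM {..<j} (\<lambda>_. borel :: real measure)))"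

definition probability_on_reals :: "real measure \<Rightarrow> bool" where
  "probability_on_reals m \<longleftrightarrow> prob_space m \<and> sets m = sets borel"

definition nondegenerate :: "real measure \<Rightarrow> bool" where
  "nondegenerate m \<longleftrightarrow> (\<forall>S. open S \<and> S \<noteq> {} \<longrightarrow> measure m S > 0)"

text \<open>The decomposition of a pithy sentence into \<open>xs\<close>, \<open>y\<close> and \<open>\<psi>\<close> is
  unique, because \<open>\<psi>\<close> is quantifier-free.\<close>

definition witnesses ::
    "'r language \<Rightarrow> ('r, real) struct \<Rightarrow> real measure \<Rightarrow> 'r formula set \<Rightarrow> bool" where
  "witnesses L P m T \<longleftrightarrow>
     (\<forall>xs y \<psi>. pithy_parts L xs y \<psi> \<and> Alls xs (Exists y \<psi>) \<in> T \<longrightarrow>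
        (\<forall>as. length as = length xs \<longrightarrow>
           (\<exists>b\<in>set as. holds_at P \<psi> (xs @ [y]) (as @ [b])) \<or>
           measure m {b. holds_at P \<psi> (xs @ [y]) (as @ [b])} > 0))"

definition strongly_witnesses ::
    "'r language \<Rightarrow> ('r, real) struct \<Rightarrow> 'r formula set \<Rightarrow> bool" where
  "strongly_witnesses L P T \<longleftrightarrow>
     (\<forall>m. probability_on_reals m \<and> nondegenerate m \<longrightarrow> witnesses L P m T)"

end

theory Submission
  imports Defs
begin

text \<open>
  A finite injective tuple of elements of a model of \<open>T\<close> stands for a finite quantifier-free type
  consistent with \<open>T\<close>. At stage \<open>n\<close> such a tuple is indexed by finitely many dyadic intervals of
  length \<open>2\<^sup>-\<^sup>n\<close>, which cover only a bounded part of the line. To pass to the next stage one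
  adds the witnesses in the current model required by finitely many sentences of \<open>T\<close>, places them
  in intervals to which nothing has been assigned yet, gives both halves of an old interval the
  element of that interval, and uses duplication to make the elements distinct. Duplication
  preserves the type of every subtuple without repetitions, so the type of a tuple of distinct
  reals is the same at all stages whose intervals cover and separate it. A witness for such a
  tuple is attached to a whole interval, which has positive measure.
\<close>

section \<open>Quantifier-free types of tuples\<close>

text \<open>Only atomic formulas are compared; \<open>same_type_sat\<close> extends the agreement to
  all quantifier-free formulas. The index type is left open because variables, elements, cells and
  reals all serve as indices.\<close>

definition same_type ::
    "'r language \<Rightarrow> ('r, 'u) struct \<Rightarrow> ('v \<Rightarrow> 'u) \<Rightarrow> ('r, 'w) struct \<Rightarrow> ('v \<Rightarrow> 'w) \<Rightarrow> 'v set \<Rightarrow> bool"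
  where
  "same_type L M f N g A \<longleftrightarrow>
     (\<forall>x\<in>A. \<forall>y\<in>A. f x = f y \<longleftrightarrow> g x = g y) \<and>
     (\<forall>r xs. L r = Some (length xs) \<and> set xs \<subseteq> A \<longrightarrow>
        (map f xs \<in> interp M r \<longleftrightarrow> map g xs \<in> interp N r))"

lemma same_type_refl: "same_type L M f M f A"
  by (simp add: same_type_def)

lemma same_type_sym: "same_type L M f N g A \<Longrightarrow> same_type L N g M f A"
  by (simp add: same_type_def)

lemma same_type_trans:
  "same_type L M f N g A \<Longrightarrow> same_type L N g K h A \<Longrightarrow> same_type L M f K h A"
  by (simp add: same_type_def)

text \<open>Renaming by \<open>k\<close> turns an atomic formula over \<open>B\<close> into one over
  \<open>A\<close>. As \<open>k\<close> may identify indices, this also covers tuples with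
  repetitions.\<close>

lemma same_type_comp:
  assumes "same_type L M f N g A" and "k ` B \<subseteq> A"
  shows "same_type L M (f \<circ> k) N (g \<circ> k) B"
  unfolding same_type_def
proof (intro conjI ballI allI impI)
  fix x y assume "x \<in> B" "y \<in> B"
  then have "k x \<in> A" "k y \<in> A" using assms(2) by auto
  then show "(f \<circ> k) x = (f \<circ> k) y \<longleftrightarrow> (g \<circ> k) x = (g \<circ> k) y"
    using assms(1) by (simp add: same_type_def)
next
  fix r xs assume *: "L r = Some (length xs) \<and> set xs \<subseteq> B"
  have "map f (map k xs) \<in> interp M r \<longleftrightarrow> map g (map k xs) \<in> interp N r"
    using assms * unfolding same_type_def by (metis image_mono length_map list.set_map order_trans)
  then show "map (f \<circ> k) xs \<in> interp M r \<longleftrightarrow> map (g \<circ> k) xs \<in> interp N r"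
    by simp
qed

lemma same_type_cong:
  fixes f f' :: "'v \<Rightarrow> 'u" and g g' :: "'v \<Rightarrow> 'w"
  assumes "\<And>x. x \<in> A \<Longrightarrow> f x = f' x" and "\<And>x. x \<in> A \<Longrightarrow> g x = g' x"
  shows "same_type L M f N g A \<longleftrightarrow> same_type L M f' N g' A"
proof -
  have imp: "same_type L M f' N g' A"
    if st: "same_type L M f N g A" and eq: "\<forall>x\<in>A. f x = f' x" "\<forall>x\<in>A. g x = g' x"
    for f f' :: "'v \<Rightarrow> 'u" and g g' :: "'v \<Rightarrow> 'w"
    unfolding same_type_def
  proof (intro conjI ballI allI impI)
    fix x y assume "x \<in> A" "y \<in> A"
    then show "f' x = f' y \<longleftrightarrow> g' x = g' y"
      using st eq by (simp add: same_type_def)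
  next
    fix r xs assume xs: "L r = Some (length xs) \<and> set xs \<subseteq> A"
    then have "map f' xs = map f xs" "map g' xs = map g xs" using eq by auto
    then show "map f' xs \<in> interp M r \<longleftrightarrow> map g' xs \<in> interp N r"
      using st xs by (simp only: same_type_def)
  qed
  show ?thesis
    using imp[of f g f' g'] imp[of f' g' f g] assms by auto
qed

lemma same_type_inj_on: "same_type L M f N g A \<Longrightarrow> inj_on f A \<longleftrightarrow> inj_on g A"
  unfolding same_type_def inj_on_def by meson

lemma same_type_sat:
  assumes "same_type L M f N g A" and "well_formed L \<phi>" and "qf \<phi>" and "fv \<phi> \<subseteq> A"
  shows "sat M f \<phi> \<longleftrightarrow> sat N g \<phi>"
  using assms(2-)
proof (induction \<phi>)
  case (Rel r xs)
  then show ?case using assms(1) by (simp add: same_type_def)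
next
  case (Eq x y)
  then show ?case using assms(1) by (simp add: same_type_def)
next
  case (Conj F)
  have "sat M f (F i) \<longleftrightarrow> sat N g (F i)" for i
    using Conj by (auto simp: UN_subset_iff)
  then show ?case by simp
next
  case (Disj F)
  have "sat M f (F i) \<longleftrightarrow> sat N g (F i)" for i
    using Disj by (auto simp: UN_subset_iff)
  then show ?case by simp
qed auto

text \<open>Assignments that agree on the free variables have the same type there, so
  \<open>same_type_sat\<close> applies within a single structure.\<close>

lemma sat_cong:
  assumes "well_formed L \<phi>" and "qf \<phi>" and "\<And>x. x \<in> fv \<phi> \<Longrightarrow> f x = g x"
  shows "sat M f \<phi> \<longleftrightarrow> sat M g \<phi>"
proof -
  have "same_type L M f M g (fv \<phi>)"
    using same_type_cong[of "fv \<phi>" f f f g L M M] assms(3) same_type_refl[of L M f]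
    by blast
  from same_type_sat[OF this assms(1,2)] show ?thesis by simp
qed

lemma sat_map_fm: "qf \<phi> \<Longrightarrow> sat M v (map_fm id k \<phi>) \<longleftrightarrow> sat M (v \<circ> k) \<phi>"
  by (induction \<phi>) (auto simp: comp_def)

section \<open>Quantifier prefixes and evaluation along lists of variables\<close>

lemma sat_AllsD: "sat M v (Alls xs \<phi>) \<Longrightarrow> range v \<subseteq> univ M \<Longrightarrow> sat M v \<phi>"
proof (induction xs)
  case (Cons x xs)
  \<comment> \<open>The quantifier is instantiated by the value that \<open>v\<close> already gives
    to \<open>x\<close>, so the assignment does not change.\<close>
  then have "sat M (v(x := v x)) (Alls xs \<phi>)"
    by (auto simp: Alls_def simp del: fun_upd_triv)
  with Cons show ?case by simp
qed (simp add: Alls_def)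

lemma sat_Exs:
  "sat M v (Exs xs \<phi>) \<longleftrightarrow>
     (\<exists>w. (\<forall>x. x \<notin> set xs \<longrightarrow> w x = v x) \<and> (\<forall>x\<in>set xs. w x \<in> univ M) \<and> sat M w \<phi>)"
proof (induction xs arbitrary: v)
  case Nil
  have "w = v" if "\<forall>x. w x = v x" for w using that by auto
  then show ?case by (auto simp: Exs_def)
next
  case (Cons x xs)
  have "sat M v (Exs (x # xs) \<phi>) \<longleftrightarrow> (\<exists>a\<in>univ M. sat M (v(x := a)) (Exs xs \<phi>))"
    by (simp add: Exs_def)
  also have "\<dots> \<longleftrightarrow> (\<exists>w. (\<forall>z. z \<notin> set (x # xs) \<longrightarrow> w z = v z) \<and>
      (\<forall>z\<in>set (x # xs). w z \<in> univ M) \<and> sat M w \<phi>)" (is "?l \<longleftrightarrow> ?r")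
  proof
    assume ?l
    then obtain a w where "a \<in> univ M" "\<forall>z. z \<notin> set xs \<longrightarrow> w z = (v(x := a)) z"
      "\<forall>z\<in>set xs. w z \<in> univ M" "sat M w \<phi>"
      unfolding Cons by blast
    then show ?r by (intro exI[of _ w]) (auto split: if_splits)
  next
    assume ?r
    then obtain w where "\<forall>z. z \<notin> set (x # xs) \<longrightarrow> w z = v z"
      "\<forall>z\<in>set (x # xs). w z \<in> univ M" "sat M w \<phi>" by blast
    then show ?l unfolding Cons
      by (intro bexI[of _ "w x"] exI[of _ w]) auto
  qed
  finally show ?case .
qed

text \<open>The first \<open>Exists\<close> marks the end of the universal prefix, so the prefix can
  be read off the formula.\<close>

lemma Alls_Exists_inject:
  "Alls xs (Exists y \<psi>) = Alls xs' (Exists y' \<psi>') \<Longrightarrow> xs = xs' \<and> y = y' \<and> \<psi> = \<psi>'"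
proof (induction xs arbitrary: xs')
  case Nil
  then show ?case by (cases xs') (auto simp: Alls_def)
next
  case (Cons x xs)
  then show ?case by (cases xs') (auto simp: Alls_def)
qed

lemma map_of_zip_map_comp:
  assumes "length as = length xs" and "x \<in> set xs"
  shows "the (map_of (zip xs (map h as)) x) = h (the (map_of (zip xs as) x))"
  using assms by (induction as xs rule: list_induct2) auto

lemma map_of_zip_in_set:
  assumes "length as = length xs" and "x \<in> set xs"
  shows "the (map_of (zip xs as) x) \<in> set as"
  using assms by (induction as xs rule: list_induct2) auto

lemma map_of_zip_snoc:
  assumes "length as = length xs" and "y \<notin> set xs"
  shows "map_of (zip (xs @ [y]) (as @ [b])) = (map_of (zip xs as))(y \<mapsto> b)"
  using assms by (induction as xs rule: list_induct2) auto

text \<open>Evaluation at a tuple is composition with the map \<open>k\<close> from variables to the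
  indices in \<open>cs\<close>, which reduces the claim to \<open>same_type_comp\<close> and
  \<open>same_type_sat\<close>. The two assignments agree only on \<open>xs\<close>, hence the use
  of \<open>sat_cong\<close>.\<close>

lemma same_type_holds_at:
  assumes "same_type L M f N g A" and "well_formed L \<psi>" and "qf \<psi>" and "fv \<psi> \<subseteq> set xs"
    and "length cs = length xs" and "set cs \<subseteq> A"
  shows "holds_at M \<psi> xs (map f cs) \<longleftrightarrow> holds_at N \<psi> xs (map g cs)"
proof -
  define k where "k = the \<circ> map_of (zip xs cs)"
  have "k ` set xs \<subseteq> A"
    using map_of_zip_in_set[OF assms(5)] assms(6) by (auto simp: k_def)
  then have "same_type L M (f \<circ> k) N (g \<circ> k) (set xs)"
    by (rule same_type_comp[OF assms(1)])
  then have "sat M (f \<circ> k) \<psi> \<longleftrightarrow> sat N (g \<circ> k) \<psi>"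
    by (rule same_type_sat) (use assms in auto)
  moreover have "sat M (f \<circ> k) \<psi> \<longleftrightarrow> holds_at M \<psi> xs (map f cs)"
    unfolding holds_at_def
    by (rule sat_cong[OF assms(2,3)])
      (use assms(4) in \<open>auto simp: k_def map_of_zip_map_comp[OF assms(5)]\<close>)
  moreover have "sat N (g \<circ> k) \<psi> \<longleftrightarrow> holds_at N \<psi> xs (map g cs)"
    unfolding holds_at_def
    by (rule sat_cong[OF assms(2,3)])
      (use assms(4) in \<open>auto simp: k_def map_of_zip_map_comp[OF assms(5)]\<close>)
  ultimately show ?thesis by simp
qed

section \<open>Duplication in models\<close>

definition model :: "'r language \<Rightarrow> 'r formula set \<Rightarrow> ('r, 'u) struct \<Rightarrow> bool" where
  "model L T M \<longleftrightarrow> is_structure L M \<and> (\<forall>\<phi>\<in>T. \<forall>v. range v \<subseteq> univ M \<longrightarrow> sat M v \<phi>)"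

section \<open>Diagrams as complete quantifier-free types\<close>

definition literal_basis :: "'r language \<Rightarrow> 'v set \<Rightarrow> ('r, 'v) fm set" where
  "literal_basis L V =
     {Rel r xs | r xs. L r = Some (length xs) \<and> set xs \<subseteq> V} \<union> {Eq x y | x y. x \<in> V \<and> y \<in> V}"

lemma countable_literal_basis:
  fixes V :: "'v::countable set"
  assumes "countable (dom L)"
  shows "countable (literal_basis L V)"
proof -
  have "literal_basis L V \<subseteq> case_prod Rel ` (dom L \<times> UNIV) \<union> case_prod Eq ` UNIV"
    by (fastforce simp: literal_basis_def)
  moreover have "countable (case_prod Rel ` (dom L \<times> (UNIV :: 'v list set)) \<union>
      case_prod (Eq :: 'v \<Rightarrow> 'v \<Rightarrow> ('a, 'v) fm) ` UNIV)"
    using assms by (intro countable_Un countable_image countable_SIGMA) auto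
  ultimately show ?thesis by (rule countable_subset)
qed

text \<open>The formula isolating the quantifier-free type of \<open>v\<close> on \<open>V\<close>.
  Conjunctions are indexed by the natural numbers, hence the enumeration of the atomic formulas by
  \<open>from_nat_into\<close>.\<close>

definition diagram ::
    "'r language \<Rightarrow> ('r, 'u) struct \<Rightarrow> ('v \<Rightarrow> 'u) \<Rightarrow> 'v set \<Rightarrow> ('r, 'v) fm" where
  "diagram L M v V = Conj (\<lambda>n. let l = from_nat_into (literal_basis L V) n
     in if sat M v l then l else Neg l)"

context
  fixes L :: "'r language" and V :: "nat set"
  assumes L: "countable (dom L)" and V: "V \<noteq> {}"
begin

lemma literal_basis_nonempty: "literal_basis L V \<noteq> {}"
  using V by (auto simp: literal_basis_def)

text \<open>The enumeration is onto: the basis is countable, and it is nonempty because a variable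
  of \<open>V\<close> yields an equation.\<close>

lemma ball_literal_basis:
  "(\<forall>n. Q (from_nat_into (literal_basis L V) n)) \<longleftrightarrow> (\<forall>l\<in>literal_basis L V. Q l)"
  by (metis L countable_literal_basis from_nat_into from_nat_into_surj literal_basis_nonempty)

text \<open>A conjunct holds under \<open>w\<close> exactly when its atomic formula has the same
  truth value under \<open>v\<close> and \<open>w\<close>.\<close>

lemma sat_diagram:
  "sat N w (diagram L M v V) \<longleftrightarrow> same_type L M v N w V"
proof -
  have "sat N w (diagram L M v V) \<longleftrightarrow>
      (\<forall>l\<in>literal_basis L V. sat M v l \<longleftrightarrow> sat N w l)"
    unfolding ball_literal_basis[symmetric] by (auto simp: diagram_def Let_def)
  also have "\<dots> \<longleftrightarrow> same_type L M v N w V"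
  proof -
    have "(\<forall>l\<in>literal_basis L V. Q l) \<longleftrightarrow> (\<forall>x\<in>V. \<forall>y\<in>V. Q (Eq x y)) \<and>
        (\<forall>r xs. L r = Some (length xs) \<and> set xs \<subseteq> V \<longrightarrow> Q (Rel r xs))" for Q
      unfolding literal_basis_def by blast
    then show ?thesis by (simp add: same_type_def)
  qed
  finally show ?thesis .
qed

lemma qf_diagram: "qf (diagram L M v V)"
proof -
  have "\<forall>l\<in>literal_basis L V. qf l" by (auto simp: literal_basis_def)
  then show ?thesis
    unfolding ball_literal_basis[symmetric] by (auto simp: diagram_def Let_def)
qed

lemma well_formed_diagram: "well_formed L (diagram L M v V)"
proof -
  have "\<forall>l\<in>literal_basis L V. well_formed L l" by (auto simp: literal_basis_def)
  then show ?thesis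
    unfolding ball_literal_basis[symmetric] by (auto simp: diagram_def Let_def)
qed

text \<open>The equations \<open>Eq x x\<close> make every variable of \<open>V\<close> occur, as
  \<open>qf_type\<close> requires equality and not just inclusion.\<close>

lemma fv_diagram: "fv (diagram L M v V) = V"
proof -
  have "fv (diagram L M v V) = (\<Union>n. fv (from_nat_into (literal_basis L V) n))"
    by (auto simp: diagram_def Let_def split: if_splits)
  also have "\<dots> = (\<Union>l\<in>literal_basis L V. fv l)"
    using ball_literal_basis[of "\<lambda>l. x \<notin> fv l" for x] by blast
  also have "\<dots> = V"
    by (fastforce simp: literal_basis_def)
  finally show ?thesis .
qed

end

text \<open>Whatever satisfies the diagram has the type of \<open>v\<close>, so a quantifier-free
  formula has there the truth value it has in \<open>M\<close>; this gives completeness. Consistency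
  is witnessed by \<open>M\<close> itself, and injectivity passes between families of the same
  type.\<close>

lemma qf_type_diagram:
  fixes M :: "('r, 'u) struct"
  assumes L: "countable (dom L)" and M: "model L T M" and v: "\<And>x. v x \<in> univ M"
    and xs: "distinct xs" "xs \<noteq> []"
  defines "p \<equiv> diagram L M v (set xs)"
  shows "qf_type TYPE('u) L xs p" and "consistent_with TYPE('u) L T xs p"
    and "inj_on v (set xs) \<Longrightarrow> non_redundant TYPE('u) L xs p"
proof -
  have V: "set xs \<noteq> {}" using xs by simp
  note sat_p = sat_diagram[OF L V, where M = M and v = v, folded p_def]
  have ex: "sat M w (Exs xs p)" for w
    unfolding sat_Exs
  proof (intro exI conjI)
    \<comment> \<open>By \<open>sat_Exs\<close> the values outside the quantified variables must
      remain those of \<open>w\<close>.\<close>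
    let ?w = "\<lambda>x. if x \<in> set xs then v x else w x"
    show "sat M ?w p"
      unfolding sat_p
      using same_type_cong[of "set xs" v v v ?w L M M] same_type_refl[of L M v] by auto
  qed (use v in auto)
  have M': "is_structure L M" "\<And>\<phi> v. \<phi> \<in> T \<Longrightarrow> range v \<subseteq> univ M \<Longrightarrow> sat M v \<phi>"
    using M by (auto simp: model_def)
  have "entails TYPE('u) L p \<phi> \<or> entails TYPE('u) L p (Neg \<phi>)"
    if "is_formula L \<phi>" "qf \<phi>" "fv \<phi> \<subseteq> set xs" for \<phi>
  proof -
    have "sat N w \<phi> \<longleftrightarrow> sat M v \<phi>" if "same_type L M v N w (set xs)"
      for N :: "('r, 'u) struct" and w
      using same_type_sat[OF that] \<open>is_formula L \<phi>\<close> \<open>qf \<phi>\<close> \<open>fv \<phi> \<subseteq> set xs\<close>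
      by (simp add: is_formula_def)
    then show ?thesis
      unfolding entails_def sat_p by (cases "sat M v \<phi>") auto
  qed
  then show "qf_type TYPE('u) L xs p"
    using ex M'(1) xs unfolding qf_type_def has_model_def is_formula_def p_def
    by (auto simp: qf_diagram[OF L V] well_formed_diagram[OF L V] fv_diagram[OF L V])
  show "consistent_with TYPE('u) L T xs p"
    unfolding consistent_with_def has_model_def using ex M' by blast
  assume inj: "inj_on v (set xs)"
  show "non_redundant TYPE('u) L xs p"
    unfolding non_redundant_def entails_def sat_p
  proof (intro allI impI)
    fix i j and N :: "('r, 'u) struct" and w
    assume ij: "i < j \<and> j < length xs" and st: "same_type L M v N w (set xs)"
    have "inj_on w (set xs)" using same_type_inj_on[OF st] inj by simp
    then show "sat N w (Neg (Eq (xs ! i) (xs ! j)))"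
      using ij xs by (auto simp: inj_on_eq_iff nth_eq_iff_index_eq)
  qed
qed

text \<open>Duplication is applied to the diagram of \<open>A\<close> with \<open>a\<close> in first
  place, and the resulting type \<open>q\<close> is realized in a model \<open>N\<close> of
  \<open>T\<close>. There \<open>g\<close> is a copy of \<open>A\<close> and \<open>b\<close> is a
  twin of \<open>g a\<close>. In general \<open>N\<close> does not extend \<open>M\<close>, so the
  copy is compared with \<open>A\<close> by type only.\<close>

lemma duplicate_element:
  fixes M :: "('r, 'u) struct"
  assumes L: "countable (dom L)" and dup: "has_duplication TYPE('u) L T"
    and M: "model L T M" and A: "finite A" "A \<subseteq> univ M" "a \<in> A"
  obtains N :: "('r, 'u) struct" and g b where "model L T N" "g ` A \<subseteq> univ N" "b \<in> univ N"
    "inj_on g A" "b \<notin> g ` A" "same_type L M id N g A" "same_type L M id N (g(a := b)) A"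
proof -
  obtain us where us: "set us = A - {a}" "distinct us"
    using finite_distinct_list A(1) by (metis finite_Diff)
  \<comment> \<open>The element \<open>a\<close> comes first and thus becomes the value of variable
    0, the variable that is duplicated.\<close>
  define ws where "ws = a # us"
  have ws: "set ws = A" "distinct ws" using us A by (auto simp: ws_def)
  define zs where "zs = [1..<length ws]"
  define xs where "xs = 0 # zs"
  have xs: "xs = [0..<length ws]"
    unfolding xs_def zs_def by (subst (2) upt_conv_Cons) (simp_all add: ws_def)
  \<comment> \<open>The default \<open>a\<close> keeps all values of \<open>v\<close> in the
    universe, also at variables outside \<open>xs\<close>.\<close>
  define v where "v i = (if i < length ws then ws ! i else a)" for i
  define p where "p = diagram L M v (set xs)"
  have v: "v i \<in> univ M" for i
    using A ws by (auto simp: v_def)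
  have inj_v: "inj_on v (set xs)"
    using ws by (auto simp: inj_on_def xs v_def nth_eq_iff_index_eq)
  have v_img: "v ` set xs = A"
    using ws(1) by (force simp: xs v_def in_set_conv_nth image_iff)
  have dxs: "distinct xs" "xs \<noteq> []" by (auto simp: xs) (simp add: ws_def)
  note type_p = qf_type_diagram[where v = v, OF L M v dxs, folded p_def]
  obtain y q where q: "qf_type TYPE('u) L (0 # y # zs) q"
    "non_redundant TYPE('u) L (0 # y # zs) q" "consistent_with TYPE('u) L T (0 # y # zs) q"
    "entails TYPE('u) L q p" "entails TYPE('u) L q (subst 0 y p)"
    using dup[unfolded has_duplication_def] type_p(1,2) type_p(3)[OF inj_v]
    unfolding xs_def by blast
  obtain N :: "('r, 'u) struct" where N: "model L T N"
    "\<And>v. range v \<subseteq> univ N \<Longrightarrow> sat N v (Exs (0 # y # zs) q)"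
    using q(3) unfolding consistent_with_def has_model_def model_def by blast
  then obtain u0 where u0: "u0 \<in> univ N" by (auto simp: model_def is_structure_def)
  obtain w where w: "\<And>x. x \<notin> set (0 # y # zs) \<Longrightarrow> w x = u0"
    "\<forall>x\<in>set (0 # y # zs). w x \<in> univ N" "sat N w q"
    using N(2)[of "\<lambda>_. u0"] u0 unfolding sat_Exs by blast
  have rw: "range w \<subseteq> univ N" using w(1,2) u0 by blast
  have N': "is_structure L N" using N by (simp add: model_def)
  have V: "set xs \<noteq> {}" using dxs by simp
  have wp: "same_type L M v N w (set xs)"
    using q(4) N' rw w(3) unfolding entails_def p_def sat_diagram[OF L V] by blast
  \<comment> \<open>Satisfying \<open>subst 0 y p\<close> under \<open>w\<close> means satisfying
    \<open>p\<close> with the value of variable 0 replaced by \<open>w y\<close>.\<close>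
  have "sat N (w \<circ> id(0 := y)) p"
    using q(5) N' rw w(3) sat_map_fm[OF qf_diagram[OF L V]]
    unfolding entails_def p_def subst_def by blast
  then have wp': "same_type L M v N (w \<circ> id(0 := y)) (set xs)"
    unfolding p_def sat_diagram[OF L V] .
  \<comment> \<open>Since \<open>v\<close> enumerates \<open>A\<close> injectively, its inverse
    \<open>k\<close> turns statements about variables into statements about elements; the copy of
    \<open>A\<close> is \<open>w \<circ> k\<close>.\<close>
  define k where "k = the_inv_into (set xs) v"
  have k: "k ` A \<subseteq> set xs" "\<And>x. x \<in> A \<Longrightarrow> v (k x) = x" "\<And>i. i \<in> set xs \<Longrightarrow> k (v i) = i"
    using the_inv_into_into[OF inj_v _ order_refl] f_the_inv_into_f[OF inj_v]
      the_inv_into_f_f[OF inj_v] by (auto simp: k_def v_img)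
  have ka: "k a = 0"
    using k(3)[of 0] by (simp add: v_def ws_def xs)
  have k0: "k x = 0 \<longleftrightarrow> x = a" if "x \<in> A" for x
    using k(2)[OF that] k(2)[OF A(3)] ka by metis
  have vk: "(v \<circ> k) x = id x" if "x \<in> A" for x using k(2) that by simp
  have s1: "same_type L M id N (w \<circ> k) A"
    using same_type_comp[OF wp k(1)] same_type_cong[of A "v \<circ> k" id "w \<circ> k" "w \<circ> k"] vk by blast
  have wk: "(w \<circ> id(0 := y) \<circ> k) x = ((w \<circ> k)(a := w y)) x" if "x \<in> A" for x
    using k0[OF that] by simp
  have s2: "same_type L M id N ((w \<circ> k)(a := w y)) A"
    using same_type_comp[OF wp' k(1)]
      same_type_cong[of A "v \<circ> k" id "w \<circ> id(0 := y) \<circ> k" "(w \<circ> k)(a := w y)"] vk wk by blast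
  have dy: "y \<notin> set xs" using q(1) by (auto simp: qf_type_def xs_def)
  have wy: "w y \<noteq> w i" if "i \<in> set xs" for i
  proof -
    \<comment> \<open>Non-redundancy speaks of positions: variable 0 is at position 0,
      \<open>y\<close> at position 1, and entry \<open>m\<close> of \<open>zs\<close> at position
      \<open>m + 2\<close>.\<close>
    have nr: "w ((0 # y # zs) ! i) \<noteq> w ((0 # y # zs) ! j)" if "i < j" "j < length (0 # y # zs)" for i j
      using q(2) that N' rw w(3) unfolding non_redundant_def entails_def by force
    show ?thesis
    proof (cases "i = 0")
      case True
      then show ?thesis using nr[of 0 1] by simp
    next
      case False
      then have "i \<in> set zs" using that by (simp add: xs_def)
      then obtain m where m: "m < length zs" "zs ! m = i"
        by (auto simp: in_set_conv_nth)
      then show ?thesis using nr[of 1 "Suc (Suc m)"] by auto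
    qed
  qed
  show thesis
  proof (rule that[OF N(1) _ _ _ _ s1 s2])
    show "(w \<circ> k) ` A \<subseteq> univ N" "w y \<in> univ N" using rw by auto
    show "inj_on (w \<circ> k) A" using same_type_inj_on[OF s1] by simp
    show "w y \<notin> (w \<circ> k) ` A" using wy k(1) by auto
  qed
qed

text \<open>Collisions of \<open>\<rho>\<close> are removed one by one. Each duplication enlarges
  the image and preserves the type on every set on which the current map is injective, so the
  induction runs on the number of missing values.\<close>

lemma separate_elements:
  fixes M :: "('r, 'u) struct" and \<rho> :: "'c \<Rightarrow> 'u"
  assumes L: "countable (dom L)" and dup: "has_duplication TYPE('u) L T"
    and "model L T M" and "finite S" and "\<rho> ` S \<subseteq> univ M"
  shows "\<exists>(N :: ('r, 'u) struct) e. model L T N \<and> e ` S \<subseteq> univ N \<and> inj_on e S \<and>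
    (\<forall>A\<subseteq>S. inj_on \<rho> A \<longrightarrow> same_type L M \<rho> N e A)"
  using assms(3-)
proof (induction "card S - card (\<rho> ` S)" arbitrary: M \<rho> rule: less_induct)
  case less
  show ?case
  proof (cases "inj_on \<rho> S")
    case True
    then show ?thesis using less.prems same_type_refl by blast
  next
    case False
    then obtain c d where cd: "c \<in> S" "d \<in> S" "c \<noteq> d" "\<rho> c = \<rho> d"
      by (auto simp: inj_on_def)
    obtain N :: "('r, 'u) struct" and g b where N: "model L T N" "g ` \<rho> ` S \<subseteq> univ N" "b \<in> univ N"
      "inj_on g (\<rho> ` S)" "b \<notin> g ` \<rho> ` S" "same_type L M id N g (\<rho> ` S)"
      "same_type L M id N (g(\<rho> c := b)) (\<rho> ` S)"
      using duplicate_element[OF L dup less.prems(1), of "\<rho> ` S" "\<rho> c"] less.prems cd by blast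
    \<comment> \<open>Of the indices sharing the value \<open>\<rho> c\<close>, only
      \<open>c\<close> moves to the twin \<open>b\<close>; all others follow the copy
      \<open>g\<close>.\<close>
    define \<sigma> where "\<sigma> s = (if s = c then b else g (\<rho> s))" for s
    \<comment> \<open>The index \<open>d\<close> still takes the value \<open>g (\<rho> c)\<close>,
      so no old value is lost while \<open>b\<close> is gained.\<close>
    have "insert b (g ` \<rho> ` S) \<subseteq> \<sigma> ` S"
    proof -
      have "b \<in> \<sigma> ` S" using cd by (auto simp: \<sigma>_def)
      moreover have "g (\<rho> s) \<in> \<sigma> ` S" if "s \<in> S" for s
      proof (rule image_eqI)
        show "g (\<rho> s) = \<sigma> (if s = c then d else s)" "(if s = c then d else s) \<in> S"
          using cd that by (auto simp: \<sigma>_def)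
      qed
      ultimately show ?thesis by blast
    qed
    then have "card (insert b (g ` \<rho> ` S)) \<le> card (\<sigma> ` S)"
      using less.prems by (intro card_mono) auto
    then have "card (\<rho> ` S) < card (\<sigma> ` S)"
      using N(4,5) less.prems by (simp add: card_image)
    moreover have "card (\<sigma> ` S) \<le> card S" using less.prems by (simp add: card_image_le)
    ultimately have dec: "card S - card (\<sigma> ` S) < card S - card (\<rho> ` S)" by simp
    have "\<sigma> ` S \<subseteq> univ N" using N by (auto simp: \<sigma>_def)
    then obtain K :: "('r, 'u) struct" and e where K: "model L T K" "e ` S \<subseteq> univ K" "inj_on e S"
      "\<And>A. A \<subseteq> S \<Longrightarrow> inj_on \<sigma> A \<Longrightarrow> same_type L N \<sigma> K e A"
      using less.hyps[OF dec N(1) less.prems(2)] by blast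
    have "same_type L M \<rho> K e A" if A: "A \<subseteq> S" "inj_on \<rho> A" for A
    proof -
      \<comment> \<open>If \<open>A\<close> contains \<open>c\<close>, then by injectivity no other
        index of \<open>A\<close> has the value \<open>\<rho> c\<close>, and \<open>\<sigma>\<close>
        is there \<open>g(\<rho> c := b)\<close> after \<open>\<rho>\<close>. Otherwise it is
        \<open>g\<close> after \<open>\<rho>\<close>. Both versions of the copy have the original
        type.\<close>
      have st: "same_type L M \<rho> N \<sigma> A"
      proof (cases "c \<in> A")
        case True
        have "\<rho> s = \<rho> c \<longleftrightarrow> s = c" if "s \<in> A" for s
          using A(2) True that by (auto simp: inj_on_def)
        then have "same_type L M (id \<circ> \<rho>) N (g(\<rho> c := b) \<circ> \<rho>) A \<longleftrightarrow> same_type L M \<rho> N \<sigma> A"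
          by (intro same_type_cong) (auto simp: \<sigma>_def)
        then show ?thesis using same_type_comp[OF N(7), of \<rho> A] A by blast
      next
        case False
        then have "same_type L M (id \<circ> \<rho>) N (g \<circ> \<rho>) A \<longleftrightarrow> same_type L M \<rho> N \<sigma> A"
          by (intro same_type_cong) (auto simp: \<sigma>_def)
        then show ?thesis using same_type_comp[OF N(6), of \<rho> A] A by blast
      qed
      have "inj_on \<sigma> A" using same_type_inj_on[OF st] A(2) by simp
      then show ?thesis by (rule same_type_trans[OF st K(4)[OF A(1)]])
    qed
    then show ?thesis using K by blast
  qed
qed

section \<open>One step of the construction\<close>

definition tasks :: "'r language \<Rightarrow> 'r formula set \<Rightarrow> (nat list \<times> nat \<times> 'r formula) set" where
  "tasks L T = {(xs, y, \<psi>). pithy_parts L xs y \<psi> \<and> Alls xs (Exists y \<psi>) \<in> T}"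

text \<open>Unique decomposition embeds the tasks into \<open>T\<close>.\<close>

lemma countable_tasks: "countable T \<Longrightarrow> countable (tasks L T)"
proof -
  assume T: "countable T"
  have "inj_on (\<lambda>(xs, y, \<psi>). Alls xs (Exists y \<psi>)) (tasks L T)"
    by (auto simp: inj_on_def dest: Alls_Exists_inject)
  moreover have "countable ((\<lambda>(xs, y, \<psi>). Alls xs (Exists y \<psi>)) ` tasks L T)"
    by (rule countable_subset[OF _ T]) (auto simp: tasks_def)
  ultimately show ?thesis by (rule countable_image_inj_on[rotated])
qed

lemma model_witness:
  assumes M: "model L T M" and t: "(xs, y, \<psi>) \<in> tasks L T"
    and as: "set as \<subseteq> univ M" "length as = length xs"
  shows "\<exists>b\<in>univ M. holds_at M \<psi> (xs @ [y]) (as @ [b])"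
proof -
  have p: "pithy_parts L xs y \<psi>" and T: "Alls xs (Exists y \<psi>) \<in> T"
    using t by (auto simp: tasks_def)
  obtain u0 where u0: "u0 \<in> univ M" using M by (auto simp: model_def is_structure_def)
  \<comment> \<open>The default \<open>u0\<close> gives an assignment with all values in the
    universe, as satisfaction of \<open>T\<close> is stated for such assignments.\<close>
  define v where "v x = (if x \<in> set xs then the (map_of (zip xs as) x) else u0)" for x
  have v: "range v \<subseteq> univ M"
    using map_of_zip_in_set[OF as(2)] as(1) u0 by (auto simp: v_def)
  have "sat M v (Alls xs (Exists y \<psi>))"
    using M T v by (auto simp: model_def)
  from sat_AllsD[OF this v] obtain b where b: "b \<in> univ M" "sat M (v(y := b)) \<psi>" by auto
  have y: "y \<notin> set xs" and \<psi>: "well_formed L \<psi>" "qf \<psi>" "fv \<psi> \<subseteq> set (xs @ [y])"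
    using p by (auto simp: pithy_parts_def is_formula_def)
  have "the (map_of (zip (xs @ [y]) (as @ [b])) x) = (v(y := b)) x" if "x \<in> fv \<psi>" for x
    using that \<psi>(3) by (auto simp: v_def map_of_zip_snoc[OF as(2) y])
  then have "holds_at M \<psi> (xs @ [y]) (as @ [b])"
    using b(2) sat_cong[OF \<psi>(1,2), of "the \<circ> map_of (zip (xs @ [y]) (as @ [b]))" "v(y := b)" M]
    by (simp add: holds_at_def)
  then show ?thesis using b by blast
qed

text \<open>Integers index dyadic intervals, and \<open>c div 2\<close> is the interval of which
  \<open>c\<close> is a half. The map \<open>\<rho>\<close> is a provisional placement in the old
  model: both halves of an interval still share its element, and the witnesses for the tasks in
  \<open>C\<close> are already placed. The map \<open>e'\<close> is the placement after separation
  in the new model.\<close>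

definition refines ::
    "'r language \<Rightarrow> (nat list \<times> nat \<times> 'r formula) set \<Rightarrow>
     ('r, 'u) struct \<Rightarrow> int set \<Rightarrow> (int \<Rightarrow> 'u) \<Rightarrow>
     ('r, 'u) struct \<Rightarrow> int set \<Rightarrow> (int \<Rightarrow> 'u) \<Rightarrow> bool" where
  "refines L C M S e N S' e' \<longleftrightarrow>
     {c. c div 2 \<in> S} \<subseteq> S' \<and>
     (\<exists>\<rho>. (\<forall>c. c div 2 \<in> S \<longrightarrow> \<rho> c = e (c div 2)) \<and>
          (\<forall>A\<subseteq>S'. inj_on \<rho> A \<longrightarrow> same_type L M \<rho> N e' A) \<and>
          (\<forall>(xs, y, \<psi>)\<in>C. \<forall>cs. set cs \<subseteq> S \<and> length cs = length xs \<longrightarrow>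
             (\<exists>d\<in>S'. holds_at M \<psi> (xs @ [y]) (map e cs @ [\<rho> d]))))"

text \<open>Witnesses are chosen in \<open>M\<close> and placed on fresh cells, and
  \<open>separate_elements\<close> then makes the placement injective. The set \<open>B\<close>
  allows further cells to be demanded.\<close>

lemma refinement_exists:
  fixes M :: "('r, 'u) struct"
  assumes L: "countable (dom L)" and dup: "has_duplication TYPE('u) L T"
    and M: "model L T M" and S: "finite S" "e ` S \<subseteq> univ M"
    and C: "finite C" "C \<subseteq> tasks L T" and B: "finite B"
  shows "\<exists>(N :: ('r, 'u) struct) S' e'. model L T N \<and> finite S' \<and> e' ` S' \<subseteq> univ N \<and>
    inj_on e' S' \<and> B \<subseteq> S' \<and> refines L C M S e N S' e'"
proof -
  \<comment> \<open>One demand for each task and each tuple of old cells; finiteness of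
    \<open>C\<close> and \<open>S\<close> makes these finitely many.\<close>
  define J where "J = Sigma C (\<lambda>(xs, y, \<psi>). {cs. set cs \<subseteq> S \<and> length cs = length xs})"
  have "finite J"
    unfolding J_def using C(1) finite_lists_length_eq[OF S(1)] by (intro finite_SigmaI) auto
  have "\<exists>b\<in>univ M. case j of ((xs, y, \<psi>), cs) \<Rightarrow> holds_at M \<psi> (xs @ [y]) (map e cs @ [b])"
    if "j \<in> J" for j
  proof -
    obtain xs y \<psi> cs where j: "j = ((xs, y, \<psi>), cs)" by (metis prod.exhaust)
    have "set (map e cs) \<subseteq> univ M" using that S(2) by (auto simp: j J_def)
    then show ?thesis
      using model_witness[OF M, of xs y \<psi> "map e cs"] that C(2) by (auto simp: j J_def)
  qed
  then obtain f where f: "\<And>j. j \<in> J \<Longrightarrow> f j \<in> univ M"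
    "\<And>xs y \<psi> cs. ((xs, y, \<psi>), cs) \<in> J \<Longrightarrow>
      holds_at M \<psi> (xs @ [y]) (map e cs @ [f ((xs, y, \<psi>), cs)])"
    by (metis (no_types, lifting) case_prod_conv)
  define D where "D = {c. c div 2 \<in> S} \<union> B"
  have "{c. c div 2 \<in> S} \<subseteq> (\<lambda>s. 2 * s) ` S \<union> (\<lambda>s. 2 * s + 1) ` S"
  proof
    fix c :: int assume "c \<in> {c. c div 2 \<in> S}"
    moreover have "c = 2 * (c div 2) \<or> c = 2 * (c div 2) + 1" by presburger
    ultimately show "c \<in> (\<lambda>s. 2 * s) ` S \<union> (\<lambda>s. 2 * s + 1) ` S" by blast
  qed
  then have finD: "finite D"
    unfolding D_def using S(1) B by (meson finite_UnI finite_imageI finite_subset)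
  then have "infinite (- D)" by (simp add: Compl_eq_Diff_UNIV infinite_UNIV_int)
  \<comment> \<open>One fresh cell for each demand, disjoint from the halves of old cells and from
    \<open>B\<close>.\<close>
  then obtain F where F: "F \<subseteq> - D" "finite F" "card F = card J"
    by (metis infinite_arbitrarily_large)
  then obtain h where h: "bij_betw h F J"
    using \<open>finite J\<close> finite_same_card_bij by blast
  obtain u0 where u0: "u0 \<in> univ M" using M by (auto simp: model_def is_structure_def)
  \<comment> \<open>Cells of \<open>B\<close> that are not halves of old cells carry no obligation
    and receive the arbitrary element \<open>u0\<close>.\<close>
  define \<rho> where "\<rho> c = (if c \<in> F then f (h c) else if c div 2 \<in> S then e (c div 2) else u0)" for c
  have "f (h c) \<in> univ M" if "c \<in> F" for c
    using f(1) bij_betwE[OF h] that by blast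
  then have "\<rho> ` (D \<union> F) \<subseteq> univ M"
    using S(2) u0 by (auto simp: \<rho>_def)
  from separate_elements[OF L dup M _ this] obtain N :: "('r, 'u) struct" and e'
    where N: "model L T N" "e' ` (D \<union> F) \<subseteq> univ N" "inj_on e' (D \<union> F)"
      "\<forall>A\<subseteq>D \<union> F. inj_on \<rho> A \<longrightarrow> same_type L M \<rho> N e' A"
    using finD F(2) by blast
  have old: "\<rho> c = e (c div 2)" if "c div 2 \<in> S" for c
    using that F(1) by (auto simp: \<rho>_def D_def)
  have wit: "\<exists>d\<in>D \<union> F. holds_at M \<psi> (xs @ [y]) (map e cs @ [\<rho> d])"
    if "(xs, y, \<psi>) \<in> C" "set cs \<subseteq> S" "length cs = length xs" for xs y \<psi> cs
  proof -
    have j: "((xs, y, \<psi>), cs) \<in> J" using that by (auto simp: J_def)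
    then obtain d where "d \<in> F" "h d = ((xs, y, \<psi>), cs)"
      using h by (metis bij_betw_iff_bijections)
    then show ?thesis using f(2)[OF j] by (intro bexI[of _ d]) (auto simp: \<rho>_def)
  qed
  have "refines L C M S e N (D \<union> F) e'"
    unfolding refines_def using old wit N(4) by (intro conjI exI[of _ \<rho>]) (auto simp: D_def)
  then show ?thesis
    using N finD F(2) by (intro exI[of _ N] exI[of _ "D \<union> F"] exI[of _ e']) (auto simp: D_def)
qed

section \<open>Dyadic cells\<close>

text \<open>The index of the half-open dyadic interval of length \<open>2^-n\<close> containing
  \<open>x\<close>.\<close>

definition cell :: "nat \<Rightarrow> real \<Rightarrow> int" where
  "cell n x = \<lfloor>x * 2 ^ n\<rfloor>"

text \<open>Rounding down commutes with halving, for negative numbers too because \<open>div\<close>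
  rounds down.\<close>

lemma cell_Suc_div: "cell (Suc n) x div 2 = cell n x"
proof -
  have "\<lfloor>x * 2 ^ Suc n\<rfloor> div 2 = \<lfloor>x * 2 ^ Suc n / of_int 2\<rfloor>"
    by (rule floor_divide_real_eq_div[symmetric]) simp
  then show ?thesis by (simp add: cell_def)
qed

lemma cell_measurable [measurable]: "cell n \<in> borel \<rightarrow>\<^sub>M count_space UNIV"
  unfolding cell_def by measurable

lemma cell_eq_iff: "cell n x = c \<longleftrightarrow> of_int c / 2 ^ n \<le> x \<and> x < (of_int c + 1) / 2 ^ n"
  unfolding cell_def by (simp add: floor_eq_iff field_simps)

text \<open>Points of one cell are less than \<open>2^-n\<close> apart.\<close>

lemma eventually_cell_neq:
  assumes "x \<noteq> y"
  shows "\<forall>\<^sub>F n in sequentially. cell n x \<noteq> cell n y"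
proof -
  have "(\<lambda>n. (1 / 2 :: real) ^ n) \<longlonglongrightarrow> 0" by (intro LIMSEQ_power_zero) auto
  then have "\<forall>\<^sub>F n in sequentially. (1 / 2) ^ n < \<bar>x - y\<bar>"
    using assms by (intro order_tendstoD) auto
  then show ?thesis
  proof eventually_elim
    case (elim n)
    show ?case
    proof
      assume "cell n x = cell n y"
      then have "\<bar>x * 2 ^ n - y * 2 ^ n\<bar> < 1" unfolding cell_def by linarith
      then have "\<bar>x - y\<bar> * 2 ^ n < 1" by (simp add: left_diff_distrib[symmetric] abs_mult)
      then show False using elim by (simp add: power_one_over field_simps)
    qed
  qed
qed

lemma eventually_inj_on_cell:
  assumes "finite A"
  shows "\<forall>\<^sub>F n in sequentially. inj_on (cell n) A"
proof -
  have "\<forall>\<^sub>F n in sequentially. \<forall>x\<in>A. \<forall>y\<in>A. x \<noteq> y \<longrightarrow> cell n x \<noteq> cell n y"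
    using assms eventually_cell_neq by (intro eventually_ball_finite ballI) (auto simp: eventually_mono)
  then show ?thesis by eventually_elim (auto simp: inj_on_def)
qed

text \<open>The cells that make up the interval from \<open>-n\<close> to \<open>n\<close>. For
  \<open>n = 0\<close> there are none, which lets the construction start with no cells.\<close>

definition cover :: "nat \<Rightarrow> int set" where
  "cover n = {- int n * 2 ^ n ..< int n * 2 ^ n}"

lemma eventually_cell_cover: "\<forall>\<^sub>F n in sequentially. cell n x \<in> cover n"
proof -
  obtain m where m: "\<bar>x\<bar> < real m" using reals_Archimedean2 by blast
  show ?thesis
    using eventually_ge_at_top[of m]
  proof eventually_elim
    case (elim n)
    then have "- real n \<le> x" "x < real n" using m by linarith+
    then have "- real n * 2 ^ n \<le> x * 2 ^ n" "x * 2 ^ n < real n * 2 ^ n"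
      by (intro mult_right_mono mult_strict_right_mono; simp)+
    then show ?case
      unfolding cover_def cell_def by (simp add: le_floor_iff floor_less_iff)
  qed
qed

text \<open>A cell need not be open, but its interior is a nonempty open interval, to which
  nondegeneracy applies.\<close>

lemma measure_cell_pos:
  assumes "probability_on_reals m" and "nondegenerate m" and "X \<in> sets borel"
    and "\<And>x. cell n x = c \<Longrightarrow> x \<in> X"
  shows "measure m X > 0"
proof -
  interpret prob_space m using assms by (simp add: probability_on_reals_def)
  let ?I = "{of_int c / 2 ^ n <..< (of_int c + 1) / 2 ^ n :: real}"
  have "of_int c / 2 ^ n < (of_int c + 1) / (2 ^ n :: real)" by (simp add: divide_strict_right_mono)
  then have "?I \<noteq> {}" by (metis greaterThanLessThan_empty_iff not_le)
  then have "0 < measure m ?I" using assms(2) by (simp add: nondegenerate_def)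
  also have "measure m ?I \<le> measure m X"
    using assms(1,3,4) by (intro finite_measure_mono) (auto simp: probability_on_reals_def cell_eq_iff)
  finally show ?thesis .
qed

section \<open>The limit structure\<close>

text \<open>A task is required at all late stages, not just at one, because the stage that serves a
  tuple must also separate its entries. Truth of \<open>T\<close> in the models enters through the
  witness clause of \<open>refines\<close>.\<close>

locale cell_system =
  fixes L :: "'r language" and T :: "'r formula set"
    and M :: "nat \<Rightarrow> ('r, 'u) struct" and S :: "nat \<Rightarrow> int set" and e :: "nat \<Rightarrow> int \<Rightarrow> 'u"
    and C :: "nat \<Rightarrow> (nat list \<times> nat \<times> 'r formula) set"
  assumes inj_e: "inj_on (e n) (S n)"
    and cover: "cover n \<subseteq> S n"
    and refines: "refines L (C n) (M n) (S n) (e n) (M (Suc n)) (S (Suc n)) (e (Suc n))"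
    and tasks: "t \<in> tasks L T \<Longrightarrow> \<forall>\<^sub>F n in sequentially. t \<in> C n"
begin

abbreviation point :: "nat \<Rightarrow> real \<Rightarrow> 'u" where
  "point n \<equiv> e n \<circ> cell n"

definition separated :: "nat \<Rightarrow> real set \<Rightarrow> bool" where
  "separated n A \<longleftrightarrow> cell n ` A \<subseteq> S n \<and> inj_on (cell n) A"

text \<open>Any separating stage may decide a relation, since all of them give the same answer by
  \<open>separated_same_type\<close>.\<close>

definition limit :: "('r, real) struct" where
  "limit = \<lparr>univ = UNIV, interp = \<lambda>r. {as. L r = Some (length as) \<and>
     (\<exists>n. separated n (set as) \<and> map (point n) as \<in> interp (M n) r)}\<rparr>"

lemma separated_mono: "separated n A \<Longrightarrow> B \<subseteq> A \<Longrightarrow> separated n B"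
  unfolding separated_def by (meson image_mono inj_on_subset order_trans)

lemma inj_on_point: "separated n A \<Longrightarrow> inj_on (point n) A"
  unfolding separated_def by (meson comp_inj_on inj_e inj_on_subset)

lemma eventually_separated:
  assumes "finite A"
  shows "\<forall>\<^sub>F n in sequentially. separated n A"
proof -
  have "\<forall>\<^sub>F n in sequentially. \<forall>x\<in>A. cell n x \<in> cover n"
    using assms eventually_cell_cover by (simp add: eventually_ball_finite)
  with eventually_inj_on_cell[OF assms] show ?thesis
    by eventually_elim (use cover in \<open>auto simp: separated_def\<close>)
qed

text \<open>Every new cell of a point of \<open>A\<close> is a half of its old cell, so the
  provisional placement gives that point its old element. It is therefore injective on these cells,
  and separation preserves their type.\<close>

lemma separated_Suc:
  assumes "separated n A"
  shows "separated (Suc n) A" and "same_type L (M n) (point n) (M (Suc n)) (point (Suc n)) A"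
proof -
  obtain \<rho> where \<rho>: "\<And>c. c div 2 \<in> S n \<Longrightarrow> \<rho> c = e n (c div 2)"
    "\<And>A. A \<subseteq> S (Suc n) \<Longrightarrow> inj_on \<rho> A \<Longrightarrow> same_type L (M n) \<rho> (M (Suc n)) (e (Suc n)) A"
    and S: "{c. c div 2 \<in> S n} \<subseteq> S (Suc n)"
    using refines[of n] unfolding refines_def by blast
  have sub: "cell (Suc n) ` A \<subseteq> S (Suc n)"
    using assms S by (auto simp: separated_def subset_iff cell_Suc_div)
  have eq: "(\<rho> \<circ> cell (Suc n)) x = point n x" if "x \<in> A" for x
    using assms that by (auto simp: separated_def cell_Suc_div \<rho>(1))
  have inj: "inj_on (\<rho> \<circ> cell (Suc n)) A"
    using inj_on_point[OF assms] inj_on_cong eq by (metis (no_types, lifting))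
  then show "separated (Suc n) A"
    using sub by (auto simp: separated_def dest: inj_on_imageI2)
  have "same_type L (M n) \<rho> (M (Suc n)) (e (Suc n)) (cell (Suc n) ` A)"
    using \<rho>(2)[OF sub] inj inj_on_imageI by blast
  from same_type_comp[OF this order_refl]
  show "same_type L (M n) (point n) (M (Suc n)) (point (Suc n)) A"
    using same_type_cong[of A "\<rho> \<circ> cell (Suc n)" "point n"] eq by blast
qed

lemma separated_later:
  assumes "separated n A"
  shows "separated (n + k) A \<and> same_type L (M n) (point n) (M (n + k)) (point (n + k)) A"
proof (induction k)
  case 0
  then show ?case using assms same_type_refl by simp
next
  case (Suc k)
  then show ?case
    using separated_Suc[of "n + k" A] same_type_trans unfolding add_Suc_right by blast
qed

lemma separated_same_type:
  assumes "separated n A" and "separated k A"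
  shows "same_type L (M n) (point n) (M k) (point k) A"
proof (cases "n \<le> k")
  case True
  then show ?thesis using separated_later[OF assms(1), of "k - n"] by simp
next
  case False
  then have "same_type L (M k) (point k) (M n) (point n) A"
    using separated_later[OF assms(2), of "n - k"] by simp
  then show ?thesis by (rule same_type_sym)
qed

text \<open>Equality is reflected because \<open>point n\<close> is injective on \<open>A\<close>.
  For relations, stage \<open>n\<close> also separates every tuple from \<open>A\<close>, and the
  other separating stages agree with it.\<close>

lemma limit_same_type:
  assumes "separated n A"
  shows "same_type L limit id (M n) (point n) A"
  unfolding same_type_def
proof (intro conjI ballI allI impI)
  fix x y assume "x \<in> A" "y \<in> A"
  then show "id x = id y \<longleftrightarrow> point n x = point n y"
    using inj_on_point[OF assms] by (auto simp: inj_on_def)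
next
  fix r xs assume xs: "L r = Some (length xs) \<and> set xs \<subseteq> A"
  have "map (point n) xs \<in> interp (M n) r \<longleftrightarrow> map (point k) xs \<in> interp (M k) r"
    if "separated k (set xs)" for k
    using separated_same_type[OF separated_mono[OF assms] that] xs unfolding same_type_def by blast
  moreover have "map id xs \<in> interp limit r \<longleftrightarrow>
      (\<exists>k. separated k (set xs) \<and> map (point k) xs \<in> interp (M k) r)"
    using xs by (simp add: limit_def)
  ultimately show "map id xs \<in> interp limit r \<longleftrightarrow> map (point n) xs \<in> interp (M n) r"
    using xs separated_mono[OF assms, of "set xs"] by blast
qed

text \<open>At a fixed stage the answer depends only on the cells of the coordinates and on which
  coordinates coincide. Stages and lists of cells are countably many, so each relation is a
  countable union of Borel sets.\<close>

lemma limit_borel: "borel_structure L limit"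
  unfolding borel_structure_def
proof (intro conjI allI impI)
  show "is_structure L limit" "univ limit = UNIV"
    by (auto simp: is_structure_def limit_def)
next
  fix r j assume r: "L r = Some j"
  let ?P = "PiM {..<j} (\<lambda>_. borel :: real measure)"
  define Q where "Q n cs \<longleftrightarrow> set cs \<subseteq> S n \<and> length cs = j \<and> map (e n) cs \<in> interp (M n) r" for n cs
  \<comment> \<open>The last clause expresses that \<open>cell n\<close> is injective on the set of
    coordinates; it permits repeated entries, which share their cell.\<close>
  have "map f [0..<j] \<in> interp limit r \<longleftrightarrow>
     (\<exists>n. \<exists>cs\<in>Collect (Q n). (\<forall>i\<in>{..<j}. cell n (f i) = cs ! i) \<and>
       (\<forall>i\<in>{..<j}. \<forall>k\<in>{..<j}. cell n (f i) = cell n (f k) \<longrightarrow> f i = f k))" for f :: "nat \<Rightarrow> real"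
  proof -
    have "map f [0..<j] \<in> interp limit r \<longleftrightarrow>
      (\<exists>n. Q n (map (\<lambda>i. cell n (f i)) [0..<j]) \<and> inj_on (cell n) (f ` {..<j}))"
      using r by (auto simp: limit_def separated_def Q_def comp_def lessThan_atLeast0 image_image)
    also have "\<dots> \<longleftrightarrow> (\<exists>n. \<exists>cs. Q n cs \<and> (\<forall>i\<in>{..<j}. cell n (f i) = cs ! i) \<and>
       (\<forall>i\<in>{..<j}. \<forall>k\<in>{..<j}. cell n (f i) = cell n (f k) \<longrightarrow> f i = f k))"
    proof -
      have "cs = map (\<lambda>i. cell n (f i)) [0..<j]"
        if "Q n cs" "\<forall>i\<in>{..<j}. cell n (f i) = cs ! i" for n cs
        using that by (intro nth_equalityI) (auto simp: Q_def)
      moreover have "\<forall>i\<in>{..<j}. cell n (f i) = map (\<lambda>i. cell n (f i)) [0..<j] ! i" for n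
        by simp
      ultimately have "Q n (map (\<lambda>i. cell n (f i)) [0..<j]) \<longleftrightarrow>
          (\<exists>cs. Q n cs \<and> (\<forall>i\<in>{..<j}. cell n (f i) = cs ! i))" for n
        by blast
      moreover have "inj_on (cell n) (f ` {..<j}) \<longleftrightarrow>
          (\<forall>i\<in>{..<j}. \<forall>k\<in>{..<j}. cell n (f i) = cell n (f k) \<longrightarrow> f i = f k)" for n
        by (simp add: inj_on_def)
      ultimately show ?thesis by simp blast
    qed
    finally show ?thesis by blast
  qed
  then have "{f \<in> space ?P. map f [0..<j] \<in> interp limit r} = {f \<in> space ?P.
     (\<exists>n. \<exists>cs\<in>Collect (Q n). (\<forall>i\<in>{..<j}. cell n (f i) = cs ! i) \<and>
       (\<forall>i\<in>{..<j}. \<forall>k\<in>{..<j}. cell n (f i) = cell n (f k) \<longrightarrow> f i = f k))}"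
    by simp
  also have "\<dots> \<in> sets ?P"
  proof -
    have eq: "Measurable.pred ?P (\<lambda>f. f i = f k)" if "i \<in> {..<j}" "k \<in> {..<j}" for i k
    proof -
      have "(\<lambda>f. f i) \<in> borel_measurable ?P" "(\<lambda>f. f k) \<in> borel_measurable ?P"
        using that by (auto intro: measurable_component_singleton)
      then show ?thesis unfolding pred_def by (rule borel_measurable_eq)
    qed
    show ?thesis by measurable (rule eq)
  qed
  finally show "{f \<in> space ?P. map f [0..<j] \<in> interp limit r} \<in> sets ?P" .
qed

end

text \<open>Atomic formulas define preimages of Borel sets under measurable maps, and the remaining
  quantifier-free connectives are complements and countable unions and intersections. With only the
  last entry of a tuple varying, this makes the set of witnesses measurable.\<close>

lemma borel_structure_section:
  fixes v :: "'a \<Rightarrow> 'v \<Rightarrow> real"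
  assumes P: "borel_structure L P" and v: "\<And>x. (\<lambda>b. v b x) \<in> borel_measurable K"
    and "well_formed L \<psi>" and "qf \<psi>"
  shows "{b \<in> space K. sat P (v b) \<psi>} \<in> sets K"
  using assms(3,4)
proof (induction \<psi>)
  case (Rel r xs)
  define j where "j = length xs"
  let ?P = "PiM {..<j} (\<lambda>_. borel :: real measure)"
  let ?R = "{f \<in> space ?P. map f [0..<j] \<in> interp P r}"
  let ?h = "\<lambda>b. \<lambda>i\<in>{..<j}. v b (xs ! i)"
  have h: "?h \<in> K \<rightarrow>\<^sub>M ?P"
    using v by (intro measurable_restrict) simp
  have "?R \<in> sets ?P"
    using P Rel by (simp add: borel_structure_def j_def)
  then have "?h -` ?R \<inter> space K \<in> sets K" by (rule measurable_sets[OF h])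
  also have "map (?h b) [0..<j] = map (v b) xs" for b
    by (intro nth_equalityI) (auto simp: j_def)
  then have "?h -` ?R \<inter> space K = {b \<in> space K. sat P (v b) (Rel r xs)}"
    using measurable_space[OF h] by auto
  finally show ?case .
next
  case (Eq x y)
  show ?case using borel_measurable_eq[OF v v] by simp
next
  case (Neg \<psi>)
  then show ?case by (simp add: sets.sets_Collect_neg)
next
  case (Conj F)
  then show ?case by (simp add: sets.sets_Collect_countable_All)
next
  case (Disj F)
  then show ?case by (simp add: sets.sets_Collect_countable_Ex)
qed auto

section \<open>Witnesses in the limit structure\<close>

context cell_system
begin

text \<open>At a stage that separates \<open>as\<close> and contains the task,
  \<open>refines\<close> yields a cell \<open>d\<close> whose provisional element
  \<open>\<rho> d\<close> is a witness in \<open>M n\<close>. If it is the element of an entry of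
  \<open>as\<close>, that entry is a witness; otherwise every real in the cell \<open>d\<close> of
  the next stage is one.\<close>

lemma limit_witness:
  assumes t: "(xs, y, \<psi>) \<in> tasks L T" and len: "length as = length xs"
  shows "(\<exists>b\<in>set as. holds_at limit \<psi> (xs @ [y]) (as @ [b])) \<or>
    (\<exists>n c. \<forall>b. cell n b = c \<longrightarrow> holds_at limit \<psi> (xs @ [y]) (as @ [b]))"
proof -
  have p: "pithy_parts L xs y \<psi>" using t by (simp add: tasks_def)
  then have \<psi>: "well_formed L \<psi>" "qf \<psi>" "fv \<psi> \<subseteq> set (xs @ [y])"
    by (auto simp: pithy_parts_def is_formula_def)
  have "\<forall>\<^sub>F n in sequentially. separated n (set as) \<and> (xs, y, \<psi>) \<in> C n"
    using eventually_separated[of "set as"] tasks[OF t] by (simp add: eventually_conj)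
  then obtain n where n: "separated n (set as)" "(xs, y, \<psi>) \<in> C n"
    by (auto simp: eventually_sequentially)
  obtain \<rho> where \<rho>: "\<And>c. c div 2 \<in> S n \<Longrightarrow> \<rho> c = e n (c div 2)"
    "\<And>A. A \<subseteq> S (Suc n) \<Longrightarrow> inj_on \<rho> A \<Longrightarrow> same_type L (M n) \<rho> (M (Suc n)) (e (Suc n)) A"
    and wit: "\<forall>(xs, y, \<psi>)\<in>C n. \<forall>cs. set cs \<subseteq> S n \<and> length cs = length xs \<longrightarrow>
       (\<exists>d\<in>S (Suc n). holds_at (M n) \<psi> (xs @ [y]) (map (e n) cs @ [\<rho> d]))"
    using refines[of n] unfolding refines_def by blast
  have "set (map (cell n) as) \<subseteq> S n" using n(1) by (auto simp: separated_def)
  moreover have "\<forall>cs. set cs \<subseteq> S n \<and> length cs = length xs \<longrightarrow>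
       (\<exists>d\<in>S (Suc n). holds_at (M n) \<psi> (xs @ [y]) (map (e n) cs @ [\<rho> d]))"
    using bspec[OF wit n(2)] by simp
  ultimately have "\<exists>d\<in>S (Suc n).
      holds_at (M n) \<psi> (xs @ [y]) (map (e n) (map (cell n) as) @ [\<rho> d])"
    using len length_map[of "cell n" as] by metis
  then obtain d where d: "d \<in> S (Suc n)"
    "holds_at (M n) \<psi> (xs @ [y]) (map (point n) as @ [\<rho> d])"
    by auto
  show ?thesis
  proof (cases "\<rho> d \<in> point n ` set as")
    case True
    then obtain b where b: "b \<in> set as" "\<rho> d = point n b" by auto
    have "holds_at limit \<psi> (xs @ [y]) (map id (as @ [b])) \<longleftrightarrow>
        holds_at (M n) \<psi> (xs @ [y]) (map (point n) (as @ [b]))"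
      using same_type_holds_at[OF limit_same_type[OF n(1)] \<psi>] len b(1) by simp
    then show ?thesis using d b by auto
  next
    case False
    have "holds_at limit \<psi> (xs @ [y]) (as @ [b])" if b: "cell (Suc n) b = d" for b
    proof -
      have old: "\<rho> (cell (Suc n) a) = point n a" if "a \<in> set as" for a
        using n(1) that by (auto simp: separated_def cell_Suc_div \<rho>(1))
      let ?A = "set (as @ [b])"
      \<comment> \<open>The entries of \<open>as\<close> keep their old elements, and
        \<open>b\<close> receives \<open>\<rho> d\<close>, which is none of them. Hence the type of
        the extended tuple at the next stage is the provisional one in \<open>M n\<close>.\<close>
      have inj: "inj_on (\<rho> \<circ> cell (Suc n)) ?A"
      proof -
        have "inj_on (\<rho> \<circ> cell (Suc n)) (set as)"
          using inj_on_point[OF n(1)] inj_on_cong[of "set as" "\<rho> \<circ> cell (Suc n)" "point n"] old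
          by simp
        moreover have "(\<rho> \<circ> cell (Suc n)) b \<notin> (\<rho> \<circ> cell (Suc n)) ` set as"
          using False b old by (auto simp: image_iff)
        ultimately show ?thesis by (auto simp: inj_on_insert)
      qed
      have sep: "separated (Suc n) ?A"
        using inj separated_Suc(1)[OF n(1)] b d(1)
        by (auto simp: separated_def dest: inj_on_imageI2)
      have "same_type L (M n) \<rho> (M (Suc n)) (e (Suc n)) (cell (Suc n) ` ?A)"
        using \<rho>(2) sep inj inj_on_imageI unfolding separated_def by blast
      from same_type_comp[OF this order_refl]
      have "same_type L limit id (M n) (\<rho> \<circ> cell (Suc n)) ?A"
        using limit_same_type[OF sep] same_type_sym same_type_trans by blast
      from same_type_holds_at[OF this \<psi>, of "as @ [b]"]
      have "holds_at limit \<psi> (xs @ [y]) (map id (as @ [b])) \<longleftrightarrow>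
          holds_at (M n) \<psi> (xs @ [y]) (map (\<rho> \<circ> cell (Suc n)) (as @ [b]))"
        using len by simp
      moreover have "map (\<rho> \<circ> cell (Suc n)) (as @ [b]) = map (point n) as @ [\<rho> d]"
        using old b by simp
      ultimately show ?thesis using d(2) by (metis list.map_id)
    qed
    then show ?thesis by blast
  qed
qed

lemma limit_strongly_witnesses: "strongly_witnesses L limit T"
  unfolding strongly_witnesses_def witnesses_def
proof (intro allI impI)
  fix m xs y \<psi> and as :: "real list"
  assume m: "probability_on_reals m \<and> nondegenerate m"
    and t: "pithy_parts L xs y \<psi> \<and> Alls xs (Exists y \<psi>) \<in> T"
    and len: "length as = length xs"
  let ?B = "{b. holds_at limit \<psi> (xs @ [y]) (as @ [b])}"
  \<comment> \<open>In \<open>b\<close> this is the identity if \<open>x = y\<close> and constant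
    otherwise.\<close>
  have "(\<lambda>b. the (map_of (zip (xs @ [y]) (as @ [b])) x)) \<in> borel_measurable borel" for x
    using map_of_zip_snoc[OF len, of y] t by (cases "x = y") (auto simp: pithy_parts_def)
  then have B: "?B \<in> sets borel"
    using borel_structure_section[OF limit_borel,
        of "\<lambda>b. the \<circ> map_of (zip (xs @ [y]) (as @ [b]))" borel \<psi>] t
    by (auto simp: holds_at_def pithy_parts_def is_formula_def)
  have "(xs, y, \<psi>) \<in> tasks L T" using t by (simp add: tasks_def)
  from limit_witness[OF this len] consider
    "\<exists>b\<in>set as. holds_at limit \<psi> (xs @ [y]) (as @ [b])"
    | n c where "\<And>b. cell n b = c \<Longrightarrow> b \<in> ?B"
    by blast
  then show "(\<exists>b\<in>set as. holds_at limit \<psi> (xs @ [y]) (as @ [b])) \<or> measure m ?B > 0"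
    using measure_cell_pos[of m ?B] m B by cases blast+
qed

end

section \<open>Dependent choice of the stages and passage to the limit\<close>

theorem theorem3p18:
  fixes L :: "'r language" and T :: "'r formula set"
  assumes "infinite (UNIV :: 'u set)"
    and "countable (dom L)"
    and "countable T"
    and "pithy_theory L T"
    and "has_model TYPE('u) L T"
    and "has_duplication TYPE('u) L T"
  shows "\<exists>P. borel_structure L P \<and> strongly_witnesses L P T"
proof -
  obtain M0 :: "('r, 'u) struct" where M0: "model L T M0"
    using assms(5) unfolding has_model_def model_def by blast
  obtain idx :: "nat list \<times> nat \<times> 'r formula \<Rightarrow> nat" where idx: "inj_on idx (tasks L T)"
    using countable_tasks[OF assms(3), of L] by (auto simp: countable_def)
  \<comment> \<open>Each set is finite, as one refinement step requires, and every task belongs to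
    all sets from its index on.\<close>
  define C where "C n = {t \<in> tasks L T. idx t \<le> n}" for n
  have finC: "finite (C n)" for n
    by (rule inj_on_finite[of idx _ "{..n}"])
      (use idx in \<open>auto simp: C_def intro: inj_on_subset\<close>)
  \<comment> \<open>The invariant of a single stage is kept apart from the relation between
    consecutive stages, in the form that dependent choice takes.\<close>
  define good where "good n s \<longleftrightarrow> (case s of (M, S, e) \<Rightarrow>
    model L T M \<and> finite S \<and> e ` S \<subseteq> univ M \<and> inj_on e S \<and> cover n \<subseteq> S)"
    for n and s :: "('r, 'u) struct \<times> int set \<times> (int \<Rightarrow> 'u)"
  define next_stage where "next_stage n s s' \<longleftrightarrow> (case (s, s') of ((M, S, e), (N, S', e')) \<Rightarrow>
    refines L (C n) M S e N S' e')"
    for n and s s' :: "('r, 'u) struct \<times> int set \<times> (int \<Rightarrow> 'u)"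
  have "\<exists>s. good 0 s"
    \<comment> \<open>With no cells at stage 0 the placement is irrelevant, and
      \<open>cover 0\<close> is empty.\<close>
    by (rule exI[of _ "(M0, {}, undefined)"]) (simp add: good_def M0 cover_def)
  moreover have "\<exists>s'. good (Suc n) s' \<and> next_stage n s s'" if "good n s" for n s
  proof -
    obtain M S e where s: "s = (M, S, e)" by (metis prod.exhaust)
    have g: "model L T M" "finite S" "e ` S \<subseteq> univ M"
      using that by (auto simp: good_def s)
    obtain N :: "('r, 'u) struct" and S' e' where "model L T N" "finite S'" "e' ` S' \<subseteq> univ N"
      "inj_on e' S'" "cover (Suc n) \<subseteq> S'" "refines L (C n) M S e N S' e'"
      using refinement_exists[OF assms(2,6) g finC[of n], of "cover (Suc n)"]
      by (auto simp: C_def cover_def)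
    then show ?thesis
      by (intro exI[of _ "(N, S', e')"]) (simp add: good_def next_stage_def s)
  qed
  ultimately obtain s where s: "\<And>n. good n (s n)" "\<And>n. next_stage n (s n) (s (Suc n))"
    using dependent_nat_choice[of good next_stage] by blast
  interpret cell_system L T "\<lambda>n. fst (s n)" "\<lambda>n. fst (snd (s n))" "\<lambda>n. snd (snd (s n))" C
  proof
    fix n t
    show "inj_on (snd (snd (s n))) (fst (snd (s n)))" "cover n \<subseteq> fst (snd (s n))"
      using s(1)[of n] by (auto simp: good_def split: prod.splits)
    show "refines L (C n) (fst (s n)) (fst (snd (s n))) (snd (snd (s n)))
       (fst (s (Suc n))) (fst (snd (s (Suc n)))) (snd (snd (s (Suc n))))"
      using s(2)[of n] by (auto simp: next_stage_def split: prod.splits)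
    assume "t \<in> tasks L T"
    then show "\<forall>\<^sub>F n in sequentially. t \<in> C n"
      using eventually_ge_at_top[of "idx t"] by (auto simp: C_def elim: eventually_mono)
  qed
  show ?thesis using limit_borel limit_strongly_witnesses by blast
qed

end
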